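(* Let $x\in\mathbb{C}\setminus(\mathbb{R}^-\cup\{1\})$ and let $\nu$ be real with $\nu<0$. Let $\mathscr{H}_0$, $\mathfrak{M}$, $\widehat{\tau}$, $\theta_-$ and $\theta_+$ be as defined in the context. Let $K\in\mathscr{H}_0$ and let $K_1\in\mathscr{H}_0$ be defined by $$K_1(z)=\frac{1-x}{\nu(1-\nu)x}\int_0^z\frac{K(\zeta)}{\zeta}\,\mathrm{d}\zeta,\qquad z\in\mathbb{C}.$$ Then, for the unknown $E^*\in\mathscr{H}_0$, the equation $\mathfrak{M}E^*=K_1$ can be recast into (that is, is equivalent to) the singular Volterra integral equation $$\int_0^{\widehat{\tau}z}\left[\Psi_-\left(z,\frac{\xi}{z}\right)-\Psi_+\left(z,\frac{\xi}{z}\right)\right]E^*(\xi)\,\mathrm{d}\xi=z\cdot K_1(z),\qquad z\in\mathbb{C},$$ where $$\Psi_{\pm}(z,\tau)=\frac{e^{-z\,\theta_{\pm}(\tau)^{-\nu}\left(1-(1-x)\theta_{\pm}(\tau)\right)}}{\theta_{\pm}(\tau)^{-\nu}\left(-\nu+(\nu-1)\theta_{\pm}(\tau)\right)},\qquad 0\leqslant\tau\leqslant\widehat{\tau}.$$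
   Context: $\mathbb{R}^-=(-\infty,0]$. $\mathscr{H}_0$ is the complex linear space of entire functions on $\mathbb{C}$ vanishing at $0$. The operator $\mathfrak{M}$ on $\mathscr{H}_0$ is $$\mathfrak{M}f(z)=\int_0^1e^{-z\,t^{-\nu}(1-(1-x)t)}\,f\left(z\,t^{-\nu}(1-t)\right)\frac{\mathrm{d}t}{t},\qquad z\in\mathbb{C}.$$ For $\nu<0$, the function $\tau:t\in[0,1]\mapsto t^{-\nu}(1-t)$ has a unique maximum at $\widehat{t}=\nu/(\nu-1)$, with value $\widehat{\tau}=\tau(\widehat{t})=\widehat{t}^{\,-\nu}(1-\widehat{t})$. Let $\tau_-$ and $\tau_+$ be the restrictions of $\tau$ to $[0,\widehat{t}]$ and $[\widehat{t},1]$ respectively; these are bijections onto $[0,\widehat{\tau}]$, and $\theta_-=\tau_-^{-1}:[0,\widehat{\tau}]\to[0,\widehat{t}]$, $\theta_+=\tau_+^{-1}:[0,\widehat{\tau}]\to[\widehat{t},1]$ denote their inverses. The integral over $\xi$ is along the straight segment from $0$ to $\widehat{\tau}z$ in $\mathbb{C}$, so that $\xi/z\in[0,\widehat{\tau}]$; for $z=0$ the equation is understood as the trivial identity $0=0$. The values of $\Psi_\pm(z,\tau)$ at those endpoints $\tau\in\{0,\widehat{\tau}\}$ where the denominator vanishes are irrelevant. "Singular" refers to the fact that the kernel is unbounded near such an endpoint. *)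

theory Defs
  imports "HOL-Complex_Analysis.Complex_Analysis"
begin

definition entire_vanishing :: "(complex \<Rightarrow> complex) set" where
  "entire_vanishing = {f. f holomorphic_on UNIV \<and> f 0 = 0}"

definition tau :: "real \<Rightarrow> real \<Rightarrow> real" where
  "tau \<nu> t = t powr (-\<nu>) * (1 - t)"

definition t_hat :: "real \<Rightarrow> real" where
  "t_hat \<nu> = \<nu> / (\<nu> - 1)"

definition tau_hat :: "real \<Rightarrow> real" where
  "tau_hat \<nu> = tau \<nu> (t_hat \<nu>)"

text \<open>For \<open>\<nu> < 0\<close>, the restrictions of \<open>tau \<nu>\<close> to \<open>{0..t_hat \<nu>}\<close> and \<open>{t_hat \<nu>..1}\<close> are
  bijections onto \<open>{0..tau_hat \<nu>}\<close>; the values of the inverses below outside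
  \<open>{0..tau_hat \<nu>}\<close> carry no meaning.\<close>

definition theta_minus :: "real \<Rightarrow> real \<Rightarrow> real" where
  "theta_minus \<nu> = inv_into {0..t_hat \<nu>} (tau \<nu>)"

definition theta_plus :: "real \<Rightarrow> real \<Rightarrow> real" where
  "theta_plus \<nu> = inv_into {t_hat \<nu>..1} (tau \<nu>)"

text \<open>For \<open>\<nu> < 0\<close> and \<open>f \<in> entire_vanishing\<close> the integrand is \<open>O(t powr (-\<nu> - 1))\<close> as \<open>t\<close>
  tends to \<open>0\<close>, so the integral converges absolutely.\<close>

definition M_op :: "complex \<Rightarrow> real \<Rightarrow> (complex \<Rightarrow> complex) \<Rightarrow> complex \<Rightarrow> complex" where
  "M_op x \<nu> f z =
     integral {0..1} (\<lambda>t::real.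
       exp (- z * of_real (t powr (-\<nu>)) * (1 - (1 - x) * of_real t))
       * f (z * of_real (t powr (-\<nu>) * (1 - t))) / of_real t)"

text \<open>\<open>Psi_minus\<close> is unbounded near \<open>0\<close> and both kernels are unbounded near \<open>tau_hat \<nu>\<close>; at the
  endpoints where the denominator vanishes the value is \<open>0\<close> by convention, which does not affect
  integrals. Along the segment from \<open>0\<close> to \<open>tau_hat \<nu> * z\<close> the quotient \<open>\<xi> / z\<close> is real, so
  \<open>Re (\<xi> / z)\<close> is the real number to be passed as last argument.\<close>

definition Psi_minus :: "complex \<Rightarrow> real \<Rightarrow> complex \<Rightarrow> real \<Rightarrow> complex" where
  "Psi_minus x \<nu> z s =
     exp (- z * of_real (theta_minus \<nu> s powr (-\<nu>)) * (1 - (1 - x) * of_real (theta_minus \<nu> s)))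
     / of_real (theta_minus \<nu> s powr (-\<nu>) * (-\<nu> + (\<nu> - 1) * theta_minus \<nu> s))"

definition Psi_plus :: "complex \<Rightarrow> real \<Rightarrow> complex \<Rightarrow> real \<Rightarrow> complex" where
  "Psi_plus x \<nu> z s =
     exp (- z * of_real (theta_plus \<nu> s powr (-\<nu>)) * (1 - (1 - x) * of_real (theta_plus \<nu> s)))
     / of_real (theta_plus \<nu> s powr (-\<nu>) * (-\<nu> + (\<nu> - 1) * theta_plus \<nu> s))"

end

theory Submission
  imports Defs
begin

text \<open>On each of the two branches \<open>(0, t_hat \<nu>)\<close> and \<open>(t_hat \<nu>, 1)\<close> the function
  \<open>tau \<nu>\<close> is strictly monotone, so that \<open>s = tau \<nu> t\<close> is an admissible substitution in the integral
  defining \<open>M_op\<close>. Since \<open>t * tau' t = t powr (-\<nu>) * (-\<nu> + (\<nu> - 1) * t)\<close>, the measure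
  \<open>dt / t\<close> turns into \<open>ds\<close> divided by exactly the denominator of the kernels; on the second
  branch \<open>tau \<nu>\<close> decreases, whence the minus sign in front of \<open>Psi_plus\<close>. This gives, for every
  \<open>f\<close> in \<open>entire_vanishing\<close> and every \<open>z\<close>,
  \<open>M_op x \<nu> f z = integral {0..tau_hat \<nu>} (\<lambda>s. (Psi_minus x \<nu> z s - Psi_plus x \<nu> z s) * f (z * s))\<close>,
  and parametrising the segment from \<open>0\<close> to \<open>tau_hat \<nu> * z\<close> by \<open>\<xi> = s * z\<close> contributes a
  factor \<open>z\<close>. The two equations are thus the same up to multiplication by \<open>z\<close>, for \<open>z \<noteq> 0\<close>, and
  at \<open>z = 0\<close> both are trivial.

  The point that needs care is integrability: a substitution with derivative vanishing at an
  endpoint and an unbounded kernel is legitimate for absolutely integrable functions. The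
  integrand of \<open>M_op\<close> is one, because \<open>f\<close> vanishes at \<open>0\<close> and is therefore \<open>O(w)\<close> there,
  which leaves a bound by a multiple of \<open>t powr (-\<nu> - 1)\<close> (\<open>M_integrand_absolutely_integrable\<close>).
  The substitution itself is \<open>branch_substitution\<close>, and the two branches are put together in
  \<open>M_op_as_kernel_integral\<close>.\<close>

section \<open>The two branches of \<open>tau\<close>\<close>

lemma tau_has_field_derivative:
  assumes "t > 0"
  shows "(tau \<nu> has_field_derivative t powr (-\<nu> - 1) * (-\<nu> + (\<nu> - 1) * t)) (at t within S)"
proof -
  have *: "t powr (-\<nu>) = t powr (-\<nu> - 1) * t"
    using assms by (simp add: powr_diff)
  have "((\<lambda>t. t powr (-\<nu>) * (1 - t)) has_field_derivative
          (-\<nu> * t powr (-\<nu> - 1)) * (1 - t) + t powr (-\<nu>) * (-1)) (at t within S)"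
    using assms by (auto intro!: derivative_eq_intros)
  also have "(-\<nu> * t powr (-\<nu> - 1)) * (1 - t) + t powr (-\<nu>) * (-1) =
             t powr (-\<nu> - 1) * (-\<nu> + (\<nu> - 1) * t)"
    unfolding * by (simp add: algebra_simps)
  finally show ?thesis
    by (simp add: tau_def[abs_def])
qed

lemma t_hat_bounds:
  assumes "\<nu> < 0"
  shows "0 < t_hat \<nu>" "t_hat \<nu> < 1"
  using assms by (auto simp: t_hat_def field_simps)

lemma tau_slope_pos_iff:
  assumes "\<nu> < 0"
  shows "0 < -\<nu> + (\<nu> - 1) * t \<longleftrightarrow> t < t_hat \<nu>"
    and "-\<nu> + (\<nu> - 1) * t < 0 \<longleftrightarrow> t_hat \<nu> < t"
  using assms by (auto simp: t_hat_def field_simps)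

lemma continuous_on_tau:
  assumes "\<nu> < 0"
  shows "continuous_on {0..} (tau \<nu>)"
  unfolding tau_def using assms by (auto intro!: continuous_intros continuous_on_powr')

lemma tau_0: "tau \<nu> 0 = 0" and tau_1: "tau \<nu> 1 = 0"
  by (simp_all add: tau_def)

lemma tau_strict_increasing:
  assumes "\<nu> < 0" "0 \<le> a" "a < b" "b \<le> t_hat \<nu>"
  shows "tau \<nu> a < tau \<nu> b"
proof (rule DERIV_pos_imp_increasing_open[of a b])
  show "continuous_on {a..b} (tau \<nu>)"
    using continuous_on_tau[OF \<open>\<nu> < 0\<close>] by (rule continuous_on_subset) (use assms in auto)
  show "\<exists>y. (tau \<nu> has_real_derivative y) (at t) \<and> 0 < y" if "a < t" "t < b" for t
    using that assms tau_slope_pos_iff(1)[OF \<open>\<nu> < 0\<close>, of t]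
    by (intro exI[of _ "t powr (-\<nu> - 1) * (-\<nu> + (\<nu> - 1) * t)"] conjI
        tau_has_field_derivative mult_pos_pos) auto
qed (use assms in auto)

lemma tau_strict_decreasing:
  assumes "\<nu> < 0" "t_hat \<nu> \<le> a" "a < b"
  shows "tau \<nu> b < tau \<nu> a"
proof (rule DERIV_neg_imp_decreasing_open[of a b])
  have "0 < t_hat \<nu>" by (rule t_hat_bounds) fact
  show "continuous_on {a..b} (tau \<nu>)"
    using continuous_on_tau[OF \<open>\<nu> < 0\<close>]
    by (rule continuous_on_subset) (use assms \<open>0 < t_hat \<nu>\<close> in auto)
  show "\<exists>y. (tau \<nu> has_real_derivative y) (at t) \<and> y < 0" if "a < t" "t < b" for t
    using that assms tau_slope_pos_iff(2)[OF \<open>\<nu> < 0\<close>, of t] \<open>0 < t_hat \<nu>\<close>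
    by (intro exI[of _ "t powr (-\<nu> - 1) * (-\<nu> + (\<nu> - 1) * t)"] conjI
        tau_has_field_derivative mult_pos_neg) auto
qed (use assms in auto)

lemma inj_on_tau:
  assumes "\<nu> < 0"
  shows "inj_on (tau \<nu>) {0..t_hat \<nu>}" "inj_on (tau \<nu>) {t_hat \<nu>..1}"
proof -
  show "inj_on (tau \<nu>) {0..t_hat \<nu>}"
    by (rule linorder_inj_onI') (use tau_strict_increasing[OF assms] in fastforce)
  show "inj_on (tau \<nu>) {t_hat \<nu>..1}"
    by (rule linorder_inj_onI') (use tau_strict_decreasing[OF assms] in fastforce)
qed

lemma tau_image_lower_branch:
  assumes "\<nu> < 0"
  shows "tau \<nu> ` {0<..<t_hat \<nu>} = {0<..<tau_hat \<nu>}"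
proof (intro equalityI subsetI)
  fix s assume "s \<in> tau \<nu> ` {0<..<t_hat \<nu>}"
  then show "s \<in> {0<..<tau_hat \<nu>}"
    using tau_strict_increasing[OF assms, of 0] tau_strict_increasing[OF assms, of _ "t_hat \<nu>"]
    by (auto simp: tau_hat_def tau_0)
next
  fix s assume s: "s \<in> {0<..<tau_hat \<nu>}"
  have "continuous_on {0..t_hat \<nu>} (tau \<nu>)"
    using continuous_on_tau[OF assms] by (rule continuous_on_subset) auto
  then obtain t where t: "0 \<le> t" "t \<le> t_hat \<nu>" "tau \<nu> t = s"
    using IVT'[of "tau \<nu>" 0 s "t_hat \<nu>"] s t_hat_bounds(1)[OF assms]
    by (auto simp: tau_0 tau_hat_def)
  moreover have "t \<noteq> 0" "t \<noteq> t_hat \<nu>"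
    using s t by (auto simp: tau_0 tau_hat_def)
  ultimately show "s \<in> tau \<nu> ` {0<..<t_hat \<nu>}"
    by (intro image_eqI[of _ _ t]) auto
qed

lemma tau_image_upper_branch:
  assumes "\<nu> < 0"
  shows "tau \<nu> ` {t_hat \<nu><..<1} = {0<..<tau_hat \<nu>}"
proof (intro equalityI subsetI)
  fix s assume "s \<in> tau \<nu> ` {t_hat \<nu><..<1}"
  then show "s \<in> {0<..<tau_hat \<nu>}"
    using tau_strict_decreasing[OF assms, of "t_hat \<nu>"] tau_strict_decreasing[OF assms, of _ 1]
    by (auto simp: tau_hat_def tau_1)
next
  fix s assume s: "s \<in> {0<..<tau_hat \<nu>}"
  have "continuous_on {t_hat \<nu>..1} (tau \<nu>)"
    using continuous_on_tau[OF assms]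
    by (rule continuous_on_subset) (use t_hat_bounds[OF assms] in auto)
  then obtain t where t: "t_hat \<nu> \<le> t" "t \<le> 1" "tau \<nu> t = s"
    using IVT2'[of "tau \<nu>" 1 s "t_hat \<nu>"] s t_hat_bounds(2)[OF assms]
    by (auto simp: tau_1 tau_hat_def)
  moreover have "t \<noteq> 1" "t \<noteq> t_hat \<nu>"
    using s t by (auto simp: tau_1 tau_hat_def)
  ultimately show "s \<in> tau \<nu> ` {t_hat \<nu><..<1}"
    by (intro image_eqI[of _ _ t]) auto
qed

lemma tau_hat_pos:
  assumes "\<nu> < 0"
  shows "0 < tau_hat \<nu>"
  using t_hat_bounds[OF assms] by (simp add: tau_hat_def tau_def)

lemma theta_minus_tau:
  assumes "\<nu> < 0" "t \<in> {0<..<t_hat \<nu>}"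
  shows "theta_minus \<nu> (tau \<nu> t) = t"
  unfolding theta_minus_def using assms by (intro inv_into_f_f inj_on_tau) auto

lemma theta_plus_tau:
  assumes "\<nu> < 0" "t \<in> {t_hat \<nu><..<1}"
  shows "theta_plus \<nu> (tau \<nu> t) = t"
  unfolding theta_plus_def using assms by (intro inv_into_f_f inj_on_tau) auto

section \<open>Absolute integrability of the integrand\<close>

definition M_weight :: "complex \<Rightarrow> real \<Rightarrow> complex \<Rightarrow> real \<Rightarrow> complex" where
  "M_weight x \<nu> z t = exp (- z * of_real (t powr (-\<nu>)) * (1 - (1 - x) * of_real t))"

definition M_integrand ::
  "complex \<Rightarrow> real \<Rightarrow> (complex \<Rightarrow> complex) \<Rightarrow> complex \<Rightarrow> real \<Rightarrow> complex" where
  "M_integrand x \<nu> f z t = M_weight x \<nu> z t * f (z * of_real (tau \<nu> t)) / of_real t"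

lemma M_op_eq: "M_op x \<nu> f z = integral {0..1} (M_integrand x \<nu> f z)"
  by (simp add: M_op_def M_integrand_def[abs_def] M_weight_def tau_def)

lemma entire_vanishing_linear_bound:
  assumes "f \<in> entire_vanishing"
  obtains B where "B \<ge> 0" "\<And>w. norm w \<le> R \<Longrightarrow> norm (f w) \<le> B * norm w"
proof -
  have hol: "f holomorphic_on UNIV" and [simp]: "f 0 = 0"
    using assms by (auto simp: entire_vanishing_def)
  have "continuous_on (cball 0 R) (deriv f)"
    using hol by (intro holomorphic_on_imp_continuous_on holomorphic_deriv[of f UNIV, THEN
        holomorphic_on_subset]) auto
  then have "bounded (deriv f ` cball 0 R)"
    by (intro compact_imp_bounded compact_continuous_image) auto
  then obtain B where B: "B > 0" "\<And>w. w \<in> cball 0 R \<Longrightarrow> norm (deriv f w) \<le> B"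
    by (auto simp: bounded_pos)
  show ?thesis
  proof (rule that[of B])
    show "norm (f w) \<le> B * norm w" if "norm w \<le> R" for w
    proof -
      have "0 \<le> R" using norm_ge_zero[of w] that by linarith
      have "(f has_field_derivative deriv f u) (at u within cball 0 R)" for u
        using holomorphic_derivI[OF hol, of u] has_field_derivative_at_within by blast
      then have "norm (f w - f 0) \<le> B * norm (w - 0)"
        by (intro field_differentiable_bound[of "cball 0 R" f "deriv f" B])
           (use B that \<open>0 \<le> R\<close> in auto)
      then show ?thesis by simp
    qed
  qed (use B in auto)
qed

text \<open>The zero of \<open>f\<close> at the origin cancels the factor \<open>1 / t\<close> up to \<open>t powr (-\<nu> - 1)\<close>, whose
  exponent exceeds \<open>-1\<close>; the exponential weight is continuous on the whole interval.\<close>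

lemma M_integrand_absolutely_integrable:
  assumes "\<nu> < 0" "f \<in> entire_vanishing"
  shows "M_integrand x \<nu> f z absolutely_integrable_on {0<..<1}"
proof -
  have hol: "f holomorphic_on UNIV"
    using assms by (auto simp: entire_vanishing_def)
  have "continuous_on {0..1} (M_weight x \<nu> z)"
    unfolding M_weight_def using assms by (auto intro!: continuous_intros continuous_on_powr')
  then have "bounded (M_weight x \<nu> z ` {0..1})"
    by (intro compact_imp_bounded compact_continuous_image) auto
  then obtain C where C: "C > 0" "\<And>t. t \<in> {0..1} \<Longrightarrow> norm (M_weight x \<nu> z t) \<le> C"
    by (auto simp: bounded_pos)
  obtain B where B: "B \<ge> 0" "\<And>w. norm w \<le> norm z \<Longrightarrow> norm (f w) \<le> B * norm w"
    using entire_vanishing_linear_bound[OF assms(2)] by blast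
  show ?thesis
  proof (rule measurable_bounded_by_integrable_imp_absolutely_integrable)
    show "M_integrand x \<nu> f z \<in> borel_measurable (lebesgue_on {0<..<1})"
    proof (rule continuous_imp_measurable_on_sets_lebesgue)
      have "continuous_on {0<..<1} (\<lambda>t. f (z * of_real (tau \<nu> t)))"
        by (rule continuous_on_compose2[OF holomorphic_on_imp_continuous_on[OF hol]])
           (auto simp: tau_def intro!: continuous_intros)
      moreover have "continuous_on {0<..<1} (M_weight x \<nu> z)"
        by (rule continuous_on_subset[OF \<open>continuous_on {0..1} (M_weight x \<nu> z)\<close>]) auto
      ultimately show "continuous_on {0<..<1} (M_integrand x \<nu> f z)"
        unfolding M_integrand_def by (intro continuous_intros) auto
    qed auto
    have "(\<lambda>t. t powr (-\<nu> - 1)) integrable_on {0..1}"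
      using has_integral_powr_from_0[of "-\<nu> - 1" 1] assms by (auto simp: has_integral_iff)
    then have "(\<lambda>t. t powr (-\<nu> - 1)) integrable_on {0<..<1}"
      by (simp add: integrable_on_open_interval_real)
    then show "(\<lambda>t. C * B * norm z * t powr (-\<nu> - 1)) integrable_on {0<..<1}"
      by (rule integrable_on_mult_right)
    show "norm (M_integrand x \<nu> f z t) \<le> C * B * norm z * t powr (-\<nu> - 1)"
      if t: "t \<in> {0<..<1}" for t
    proof -
      have pow: "t powr (-\<nu>) = t powr (-\<nu> - 1) * t"
        using t by (simp add: powr_diff)
      have "t powr (-\<nu>) \<le> 1"
        using t assms by (intro powr_le1) auto
      then have tau: "0 \<le> tau \<nu> t" "tau \<nu> t \<le> 1" "tau \<nu> t \<le> t powr (-\<nu>)"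
        using t by (auto simp: tau_def intro: mult_le_one mult_left_le)
      have "norm (f (z * of_real (tau \<nu> t))) \<le> B * norm (z * of_real (tau \<nu> t))"
        using tau by (intro B) (auto simp: norm_mult intro: mult_left_le)
      also have "\<dots> \<le> B * (norm z * t powr (-\<nu>))"
        using tau B by (auto simp: norm_mult intro!: mult_left_mono)
      finally have "norm (M_weight x \<nu> z t) * norm (f (z * of_real (tau \<nu> t)))
          \<le> C * (B * (norm z * t powr (-\<nu>)))"
        using C t by (intro mult_mono) auto
      then show ?thesis
        using t unfolding M_integrand_def by (simp add: norm_mult norm_divide pow field_simps)
    qed
  qed auto
qed

section \<open>Substitution on the branches\<close>

text \<open>Substitution over unoriented sets produces \<open>\<bar>h t\<bar>\<close>, whereas the kernels \<open>Psi_minus\<close> and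
  \<open>Psi_plus\<close> are divided by the slope itself. The constant \<open>\<sigma>\<close> absorbs the resulting sign, which
  is \<open>1\<close> where \<open>g\<close> increases and \<open>-1\<close> where it decreases.\<close>

lemma has_integral_change_of_variables_signed:
  fixes F G :: "real \<Rightarrow> complex" and g h :: "real \<Rightarrow> real"
  assumes "S \<in> sets lebesgue"
    and "\<And>t. t \<in> S \<Longrightarrow> (g has_field_derivative h t) (at t within S)"
    and "inj_on g S"
    and "G absolutely_integrable_on S"
    and pull: "\<And>t. t \<in> S \<Longrightarrow> \<bar>h t\<bar> *\<^sub>R F (g t) = \<sigma> * G t"
  shows "(F has_integral \<sigma> * integral S G) (g ` S)"
proof -
  have "(\<lambda>t. \<sigma> * G t) absolutely_integrable_on S"
    using assms(4) by (intro set_integrable_mult_right) auto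
  then have "(\<lambda>t. \<bar>h t\<bar> *\<^sub>R F (g t)) absolutely_integrable_on S"
    by (rule absolutely_integrable_spike[where S = "{}"]) (auto simp: pull)
  moreover have "integral S (\<lambda>t. \<bar>h t\<bar> *\<^sub>R F (g t)) = \<sigma> * integral S G"
    using integral_cong[OF pull] by simp
  ultimately have "F absolutely_integrable_on g ` S" "integral (g ` S) F = \<sigma> * integral S G"
    using has_absolute_integral_change_of_variables_real[OF assms(1-3), of F "\<sigma> * integral S G"]
    by blast+
  then show ?thesis
    by (auto simp: has_integral_iff dest: set_lebesgue_integral_eq_integral(1))
qed

text \<open>The open branches avoid \<open>0\<close> and \<open>t_hat \<nu>\<close>, where the denominators of the kernels vanish.
  Pulled back along \<open>tau\<close>, the inverses \<open>theta_minus\<close> and \<open>theta_plus\<close> disappear, and the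
  denominators become \<open>t * h t\<close> with \<open>h\<close> the derivative of \<open>tau\<close>.\<close>

lemma branch_substitution:
  assumes "\<nu> < 0" "f \<in> entire_vanishing"
  shows "((\<lambda>s. Psi_minus x \<nu> z s * f (z * of_real s)) has_integral
            integral {0<..<t_hat \<nu>} (M_integrand x \<nu> f z)) {0<..<tau_hat \<nu>}"
    and "((\<lambda>s. Psi_plus x \<nu> z s * f (z * of_real s)) has_integral
            - integral {t_hat \<nu><..<1} (M_integrand x \<nu> f z)) {0<..<tau_hat \<nu>}"
proof -
  define h where "h t = t powr (-\<nu> - 1) * (-\<nu> + (\<nu> - 1) * t)" for t
  note hat = t_hat_bounds[OF assms(1)]
  note abs_int = M_integrand_absolutely_integrable[OF assms, of x z]
  have denom: "t powr (-\<nu>) * (-\<nu> + (\<nu> - 1) * t) = t * h t" if "0 < t" for t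
    using that by (simp add: h_def powr_diff)
  have "((\<lambda>s. Psi_minus x \<nu> z s * f (z * of_real s)) has_integral
            1 * integral {0<..<t_hat \<nu>} (M_integrand x \<nu> f z)) (tau \<nu> ` {0<..<t_hat \<nu>})"
  proof (rule has_integral_change_of_variables_signed[where h = h])
    show "(tau \<nu> has_field_derivative h t) (at t within {0<..<t_hat \<nu>})"
      if "t \<in> {0<..<t_hat \<nu>}" for t
      unfolding h_def using that by (intro tau_has_field_derivative) auto
    show "inj_on (tau \<nu>) {0<..<t_hat \<nu>}"
      by (rule inj_on_subset[OF inj_on_tau(1)[OF assms(1)]]) auto
    show "M_integrand x \<nu> f z absolutely_integrable_on {0<..<t_hat \<nu>}"
      by (rule set_integrable_subset[OF abs_int]) (use hat in auto)
    show "\<bar>h t\<bar> *\<^sub>R (Psi_minus x \<nu> z (tau \<nu> t) * f (z * of_real (tau \<nu> t)))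
            = 1 * M_integrand x \<nu> f z t" if t: "t \<in> {0<..<t_hat \<nu>}" for t
    proof -
      have "h t > 0"
        using t tau_slope_pos_iff(1)[OF assms(1), of t] by (auto simp: h_def)
      moreover have "Psi_minus x \<nu> z (tau \<nu> t) = M_weight x \<nu> z t / of_real (t * h t)"
        using t denom[of t] by (simp only: Psi_minus_def theta_minus_tau[OF assms(1)] M_weight_def) auto
      ultimately show ?thesis
        by (simp add: M_integrand_def scaleR_conv_of_real)
    qed
  qed auto
  then show "((\<lambda>s. Psi_minus x \<nu> z s * f (z * of_real s)) has_integral
            integral {0<..<t_hat \<nu>} (M_integrand x \<nu> f z)) {0<..<tau_hat \<nu>}"
    by (simp add: tau_image_lower_branch[OF assms(1)])
  have "((\<lambda>s. Psi_plus x \<nu> z s * f (z * of_real s)) has_integral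
            (-1) * integral {t_hat \<nu><..<1} (M_integrand x \<nu> f z)) (tau \<nu> ` {t_hat \<nu><..<1})"
  proof (rule has_integral_change_of_variables_signed[where h = h])
    show "(tau \<nu> has_field_derivative h t) (at t within {t_hat \<nu><..<1})"
      if "t \<in> {t_hat \<nu><..<1}" for t
      unfolding h_def using that hat by (intro tau_has_field_derivative) auto
    show "inj_on (tau \<nu>) {t_hat \<nu><..<1}"
      by (rule inj_on_subset[OF inj_on_tau(2)[OF assms(1)]]) auto
    show "M_integrand x \<nu> f z absolutely_integrable_on {t_hat \<nu><..<1}"
      by (rule set_integrable_subset[OF abs_int]) (use hat in auto)
    show "\<bar>h t\<bar> *\<^sub>R (Psi_plus x \<nu> z (tau \<nu> t) * f (z * of_real (tau \<nu> t)))
            = (-1) * M_integrand x \<nu> f z t" if t: "t \<in> {t_hat \<nu><..<1}" for t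
    proof -
      have "t > 0" using t hat by auto
      moreover have "h t < 0"
        using t \<open>t > 0\<close> tau_slope_pos_iff(2)[OF assms(1), of t]
        by (auto simp: h_def mult_pos_neg)
      moreover have "Psi_plus x \<nu> z (tau \<nu> t) = M_weight x \<nu> z t / of_real (t * h t)"
        using t denom[OF \<open>0 < t\<close>]
        by (simp only: Psi_plus_def theta_plus_tau[OF assms(1)] M_weight_def)
      ultimately show ?thesis
        by (simp add: M_integrand_def scaleR_conv_of_real)
    qed
  qed auto
  then show "((\<lambda>s. Psi_plus x \<nu> z s * f (z * of_real s)) has_integral
            - integral {t_hat \<nu><..<1} (M_integrand x \<nu> f z)) {0<..<tau_hat \<nu>}"
    by (simp add: tau_image_upper_branch[OF assms(1)])
qed

section \<open>The integral transform as a Volterra operator\<close>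

lemma M_op_as_kernel_integral:
  assumes "\<nu> < 0" "f \<in> entire_vanishing"
  shows "((\<lambda>s. (Psi_minus x \<nu> z s - Psi_plus x \<nu> z s) * f (z * of_real s))
            has_integral M_op x \<nu> f z) {0..tau_hat \<nu>}"
proof -
  let ?G = "M_integrand x \<nu> f z"
  have "?G integrable_on {0..1}"
    using set_lebesgue_integral_eq_integral(1)[OF M_integrand_absolutely_integrable[OF assms]]
    by (simp add: integrable_on_open_interval_real)
  then have "M_op x \<nu> f z = integral {0..t_hat \<nu>} ?G + integral {t_hat \<nu>..1} ?G"
    using t_hat_bounds[OF assms(1)]
    by (simp add: M_op_eq Henstock_Kurzweil_Integration.integral_combine)
  also have "\<dots> = integral {0<..<t_hat \<nu>} ?G - - integral {t_hat \<nu><..<1} ?G"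
    by (simp add: integral_open_interval_real)
  finally show ?thesis
    using has_integral_diff[OF branch_substitution[OF assms, of x z]]
    by (simp add: algebra_simps has_integral_Icc_iff_Ioo)
qed

text \<open>For \<open>z \<noteq> 0\<close> the factor \<open>tau_hat \<nu> * z\<close> from the derivative of the segment and the factor
  \<open>1 / tau_hat \<nu>\<close> from rescaling the parameter to \<open>{0..1}\<close> leave precisely \<open>z\<close>.\<close>

lemma M_op_as_contour_integral:
  assumes "\<nu> < 0" "f \<in> entire_vanishing" "z \<noteq> 0"
  shows "((\<lambda>\<xi>. (Psi_minus x \<nu> z (Re (\<xi> / z)) - Psi_plus x \<nu> z (Re (\<xi> / z))) * f \<xi>)
            has_contour_integral z * M_op x \<nu> f z) (linepath 0 (of_real (tau_hat \<nu>) * z))"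
proof -
  define T where "T = tau_hat \<nu>"
  define F where "F s = (Psi_minus x \<nu> z s - Psi_plus x \<nu> z s) * f (z * of_real s)" for s
  have T: "T > 0" unfolding T_def by (rule tau_hat_pos) fact
  have "((\<lambda>s. F (T * s)) has_integral (1 / \<bar>T\<bar>) *\<^sub>R M_op x \<nu> f z) ((\<lambda>s. s / T) ` {0..T})"
    unfolding F_def T_def using T
    by (intro has_integral_stretch_real[OF M_op_as_kernel_integral[OF assms(1,2)]])
       (auto simp: T_def)
  moreover have "(\<lambda>s. s / T) ` {0..T} = {0..1}"
    using T by (simp add: image_divide_atLeastAtMost)
  ultimately have "((\<lambda>s. F (T * s) * (of_real T * z)) has_integral
      ((1 / \<bar>T\<bar>) *\<^sub>R M_op x \<nu> f z) * (of_real T * z)) {0..1}"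
    using has_integral_mult_left by metis
  moreover have "((1 / \<bar>T\<bar>) *\<^sub>R M_op x \<nu> f z) * (of_real T * z) = z * M_op x \<nu> f z"
    using T by (simp add: scaleR_conv_of_real)
  moreover have "F (T * s) = (\<lambda>\<xi>. (Psi_minus x \<nu> z (Re (\<xi> / z)) - Psi_plus x \<nu> z (Re (\<xi> / z))) * f \<xi>)
      (linepath 0 (of_real T * z) s)" for s
  proof -
    have "linepath 0 (of_real T * z) s = z * of_real (T * s)"
      by (simp add: linepath_def scaleR_conv_of_real)
    moreover have "Re (z * of_real (T * s) / z) = T * s"
      using \<open>z \<noteq> 0\<close> by (simp del: of_real_mult)
    ultimately show ?thesis by (simp add: F_def)
  qed
  ultimately show ?thesis
    by (simp add: has_contour_integral_linepath T_def)
qed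

theorem corollary3p2:
  fixes x :: complex and \<nu> :: real and K K1 E :: "complex \<Rightarrow> complex"
  assumes "x \<notin> \<real>\<^sub>\<le>\<^sub>0" and "x \<noteq> 1"
    and "\<nu> < 0"
    and "K \<in> entire_vanishing"
    and "K1 \<in> entire_vanishing"
    and "\<And>z. K1 z = (1 - x) / (of_real (\<nu> * (1 - \<nu>)) * x)
                    * contour_integral (linepath 0 z) (\<lambda>\<zeta>. K \<zeta> / \<zeta>)"
    and "E \<in> entire_vanishing"
  shows "(\<forall>z. M_op x \<nu> E z = K1 z) \<longleftrightarrow>
         (\<forall>z. ((\<lambda>\<xi>. (Psi_minus x \<nu> z (Re (\<xi> / z)) - Psi_plus x \<nu> z (Re (\<xi> / z))) * E \<xi>)
                has_contour_integral z * K1 z) (linepath 0 (of_real (tau_hat \<nu>) * z)))"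
proof -
  have pointwise: "M_op x \<nu> E z = K1 z \<longleftrightarrow>
      ((\<lambda>\<xi>. (Psi_minus x \<nu> z (Re (\<xi> / z)) - Psi_plus x \<nu> z (Re (\<xi> / z))) * E \<xi>)
        has_contour_integral z * K1 z) (linepath 0 (of_real (tau_hat \<nu>) * z))" for z
  proof (cases "z = 0")
    case True
    have "E 0 = 0" "K1 0 = 0"
      using assms(5,7) by (auto simp: entire_vanishing_def)
    then show ?thesis
      using True by (simp add: M_op_def)
  next
    case False
    note contour = M_op_as_contour_integral[OF assms(3,7) False, of x]
    show ?thesis
    proof
      assume "M_op x \<nu> E z = K1 z"
      then show "((\<lambda>\<xi>. (Psi_minus x \<nu> z (Re (\<xi> / z)) - Psi_plus x \<nu> z (Re (\<xi> / z))) * E \<xi>)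
        has_contour_integral z * K1 z) (linepath 0 (of_real (tau_hat \<nu>) * z))"
        using contour by simp
    next
      assume "((\<lambda>\<xi>. (Psi_minus x \<nu> z (Re (\<xi> / z)) - Psi_plus x \<nu> z (Re (\<xi> / z))) * E \<xi>)
        has_contour_integral z * K1 z) (linepath 0 (of_real (tau_hat \<nu>) * z))"
      then have "z * M_op x \<nu> E z = z * K1 z"
        using contour has_contour_integral_unique by blast
      then show "M_op x \<nu> E z = K1 z"
        using False by simp
    qed
  qed
  show ?thesis
    by (simp only: pointwise)
qed

end
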